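(* Let $\lambda$ be a nonzero real number. For all positive integers $n,\alpha$ and every $z$, $$ \sum_{j=0}^{n}(-1)^{j}\binom{n}{j}(z-j)_{n+\alpha,\lambda}=\sum_{r=0}^{\alpha}\binom{z-n}{r}(n+r)!{n+\alpha \brace r+n}_{\lambda}. $$
   Context: For a real parameter $\mu$ the degenerate falling factorials are $(x)_{0,\mu}=1$ and $(x)_{n,\mu}=x(x-\mu)\cdots(x-(n-1)\mu)$ for $n\ge1$; $(x)_n=(x)_{n,1}$ is the usual falling factorial, and $\binom{x}{m}=(x)_m/m!$ for integers $m\ge0$. The degenerate Stirling numbers of the second kind ${n \brace k}_{\mu}$ are defined by $(x)_{n,\mu}=\sum_{k=0}^{n}{n \brace k}_{\mu}(x)_k$. *)

theory Defs
  imports Complex_Main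
begin

definition deg_ffact :: "real \<Rightarrow> 'a::real_field \<Rightarrow> nat \<Rightarrow> 'a" where
  "deg_ffact \<mu> x n = (\<Prod>i<n. x - of_nat i * of_real \<mu>)"

text \<open>The coefficient family of the expansion of the degenerate falling factorial of order
  \<open>n\<close> in the usual falling factorials; it is set to \<open>0\<close> beyond \<open>n\<close> so that it is a unique function
  of \<open>k\<close>. Existence and uniqueness are proved below.\<close>

definition deg_Stirling2 :: "real \<Rightarrow> nat \<Rightarrow> nat \<Rightarrow> real" where
  "deg_Stirling2 \<mu> n = (THE c. (\<forall>x::real. deg_ffact \<mu> x n = (\<Sum>k\<le>n. c k * deg_ffact 1 x k))
     \<and> (\<forall>k>n. c k = 0))"

lemma deg_ffact_0 [simp]: "deg_ffact \<mu> x 0 = 1"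
  by (simp add: deg_ffact_def)

lemma deg_ffact_Suc: "deg_ffact \<mu> x (Suc n) = deg_ffact \<mu> x n * (x - of_nat n * of_real \<mu>)"
  by (simp add: deg_ffact_def)

lemma deg_ffact_1_of_nat_eq_0: "m < k \<Longrightarrow> deg_ffact 1 (of_nat m) k = 0"
  unfolding deg_ffact_def by (rule prod_zero) auto

lemma deg_ffact_1_of_nat_neq_0: "k \<le> m \<Longrightarrow> deg_ffact 1 (of_nat m) k \<noteq> 0"
  unfolding deg_ffact_def by auto

lemma deg_Stirling2_exists:
  "\<exists>c. (\<forall>x::real. deg_ffact \<mu> x n = (\<Sum>k\<le>n. c k * deg_ffact 1 x k)) \<and> (\<forall>k>n. c k = 0)"
proof (induction n)
  case 0
  show ?case by (rule exI[of _ "\<lambda>k. if k = 0 then 1 else 0"]) auto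
next
  case (Suc n)
  then obtain c where c: "\<And>x::real. deg_ffact \<mu> x n = (\<Sum>k\<le>n. c k * deg_ffact 1 x k)"
    and c0: "\<And>k. k > n \<Longrightarrow> c k = 0" by blast
  define d where "d k = (if k = 0 then 0 else c (k - 1)) + (real k - real n * \<mu>) * c k" for k
  have "deg_ffact \<mu> x (Suc n) = (\<Sum>k\<le>Suc n. d k * deg_ffact 1 x k)" for x :: real
  proof -
    have "deg_ffact \<mu> x (Suc n) = (\<Sum>k\<le>n. c k * deg_ffact 1 x k * (x - real n * \<mu>))"
      by (simp add: deg_ffact_Suc c sum_distrib_right)
    also have "\<dots> = (\<Sum>k\<le>n. c k * deg_ffact 1 x (Suc k))
        + (\<Sum>k\<le>n. (real k - real n * \<mu>) * c k * deg_ffact 1 x k)"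
      by (simp add: sum.distrib[symmetric] deg_ffact_Suc algebra_simps)
    also have "(\<Sum>k\<le>n. c k * deg_ffact 1 x (Suc k))
        = (\<Sum>k\<le>Suc n. (if k = 0 then 0 else c (k - 1)) * deg_ffact 1 x k)"
      by (subst sum.atMost_Suc_shift) simp
    also have "(\<Sum>k\<le>n. (real k - real n * \<mu>) * c k * deg_ffact 1 x k)
        = (\<Sum>k\<le>Suc n. (real k - real n * \<mu>) * c k * deg_ffact 1 x k)"
      by (simp add: c0)
    finally show ?thesis
      by (simp only: d_def sum.distrib[symmetric] distrib_right)
  qed
  moreover have "\<forall>k>Suc n. d k = 0" by (auto simp: d_def c0)
  ultimately show ?case by blast
qed

lemma deg_ffact_1_coeffs_unique:
  fixes c d :: "nat \<Rightarrow> real"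
  assumes "\<And>x::real. (\<Sum>k\<le>n. c k * deg_ffact 1 x k) = (\<Sum>k\<le>n. d k * deg_ffact 1 x k)"
  shows "k \<le> n \<Longrightarrow> c k = d k"
proof (induction k rule: less_induct)
  case (less k)
  have restrict: "(\<Sum>i\<le>n. e i * deg_ffact 1 (real k) i)
      = (\<Sum>i<k. e i * deg_ffact 1 (real k) i) + e k * deg_ffact 1 (real k) k" for e :: "nat \<Rightarrow> real"
  proof -
    have "(\<Sum>i\<le>n. e i * deg_ffact 1 (real k) i) = (\<Sum>i\<le>k. e i * deg_ffact 1 (real k) i)"
      using less.prems by (intro sum.mono_neutral_right) (auto simp: deg_ffact_1_of_nat_eq_0)
    then show ?thesis by (simp flip: lessThan_Suc_atMost)
  qed
  have "(\<Sum>i<k. c i * deg_ffact 1 (real k) i) = (\<Sum>i<k. d i * deg_ffact 1 (real k) i)"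
    using less by (intro sum.cong) auto
  with assms[of "real k"] have "c k * deg_ffact 1 (real k) k = d k * deg_ffact 1 (real k) k"
    by (simp add: restrict)
  then show ?case using deg_ffact_1_of_nat_neq_0[of k k] by auto
qed

lemma deg_Stirling2_ex1:
  "\<exists>!c. (\<forall>x::real. deg_ffact \<mu> x n = (\<Sum>k\<le>n. c k * deg_ffact 1 x k)) \<and> (\<forall>k>n. c k = 0)"
proof (rule ex_ex1I[OF deg_Stirling2_exists])
  fix c d :: "nat \<Rightarrow> real"
  assume c: "(\<forall>x::real. deg_ffact \<mu> x n = (\<Sum>k\<le>n. c k * deg_ffact 1 x k)) \<and> (\<forall>k>n. c k = 0)"
    and d: "(\<forall>x::real. deg_ffact \<mu> x n = (\<Sum>k\<le>n. d k * deg_ffact 1 x k)) \<and> (\<forall>k>n. d k = 0)"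
  have "(\<Sum>k\<le>n. c k * deg_ffact 1 x k) = (\<Sum>k\<le>n. d k * deg_ffact 1 x k)" for x :: real
    using c d by metis
  then have "c k = d k" if "k \<le> n" for k
    using that by (rule deg_ffact_1_coeffs_unique)
  then show "c = d" using c d by (metis ext not_le)
qed

lemma deg_ffact_eq_sum_deg_Stirling2:
  "deg_ffact \<mu> (x::real) n = (\<Sum>k\<le>n. deg_Stirling2 \<mu> n k * deg_ffact 1 x k)"
  using theI'[OF deg_Stirling2_ex1[of \<mu> n]] unfolding deg_Stirling2_def by blast

lemma deg_Stirling2_eq_0: "k > n \<Longrightarrow> deg_Stirling2 \<mu> n k = 0"
  using theI'[OF deg_Stirling2_ex1[of \<mu> n]] unfolding deg_Stirling2_def by blast

end

theory Submission
  imports Defs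
begin

text \<open>The left-hand side is the \<open>n\<close>-th backward difference at \<open>z\<close> of the degenerate falling
  factorial of order \<open>n + \<alpha>\<close>. Expand the latter in the binomial basis \<open>x gchoose k\<close>, with coefficients
  \<open>fact k * deg_Stirling2 l (n + \<alpha>) k\<close>. By Pascal's rule one backward difference sends
  \<open>x gchoose k\<close> to \<open>(x - 1) gchoose (k - 1)\<close>, so \<open>n\<close> of them kill the terms with \<open>k < n\<close> and turn
  \<open>k = n + r\<close> into \<open>(z - n) gchoose r\<close>.\<close>

lemma deg_ffact_1_eq_gbinomial: "deg_ffact 1 x k = fact k * (x gchoose k)"
  by (simp add: deg_ffact_def gbinomial_prod_rev atLeast0LessThan)

text \<open>Split the new factor as \<open>x - n * \<mu> = (x - k) + (k - n * \<mu>)\<close>: the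
  first part raises \<open>deg_ffact 1 x k\<close> to order \<open>k + 1\<close>, the second only
  rescales it. Arbitrary coefficients over any real field let this serve both the recurrence over
  the reals and its transfer.\<close>

lemma deg_ffact_Suc_expansion:
  fixes x :: "'a::real_field" and c :: "nat \<Rightarrow> real"
  assumes expand: "deg_ffact \<mu> x n = (\<Sum>k\<le>n. of_real (c k) * deg_ffact 1 x k)"
    and vanish: "c (Suc n) = 0"
  shows "deg_ffact \<mu> x (Suc n) = (\<Sum>k\<le>Suc n.
    of_real ((if k = 0 then 0 else c (k - 1)) + (real k - real n * \<mu>) * c k) * deg_ffact 1 x k)"
proof -
  have "deg_ffact \<mu> x (Suc n)
      = (\<Sum>k\<le>n. of_real (c k) * deg_ffact 1 x k * (x - of_nat n * of_real \<mu>))"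
    by (simp add: deg_ffact_Suc expand sum_distrib_right)
  also have "\<dots> = (\<Sum>k\<le>n. of_real (c k) * deg_ffact 1 x (Suc k))
      + (\<Sum>k\<le>n. of_real ((real k - real n * \<mu>) * c k) * deg_ffact 1 x k)"
    by (simp add: sum.distrib[symmetric] deg_ffact_Suc algebra_simps)
  also have "(\<Sum>k\<le>n. of_real (c k) * deg_ffact 1 x (Suc k))
      = (\<Sum>k\<le>Suc n. of_real (if k = 0 then 0 else c (k - 1)) * deg_ffact 1 x k)"
    by (subst sum.atMost_Suc_shift) simp
  \<comment> \<open>The added term \<open>k = Suc n\<close> is zero by
    \<open>vanish\<close>.\<close>
  also have "(\<Sum>k\<le>n. of_real ((real k - real n * \<mu>) * c k) * deg_ffact 1 x k)
      = (\<Sum>k\<le>Suc n. of_real ((real k - real n * \<mu>) * c k) * deg_ffact 1 x k)"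
    by (simp add: vanish)
  finally show ?thesis
    by (simp only: sum.distrib[symmetric] distrib_right of_real_add)
qed

lemma deg_Stirling2_unique:
  assumes "\<And>x::real. deg_ffact \<mu> x n = (\<Sum>k\<le>n. c k * deg_ffact 1 x k)"
    and "\<And>k. k > n \<Longrightarrow> c k = 0"
  shows "deg_Stirling2 \<mu> n = c"
  unfolding deg_Stirling2_def using assms by (intro the1_equality[OF deg_Stirling2_ex1]) blast

lemma deg_Stirling2_Suc:
  "deg_Stirling2 \<mu> (Suc n) k = (if k = 0 then 0 else deg_Stirling2 \<mu> n (k - 1))
    + (real k - real n * \<mu>) * deg_Stirling2 \<mu> n k"
proof -
  have "deg_Stirling2 \<mu> (Suc n) = (\<lambda>k. (if k = 0 then 0 else deg_Stirling2 \<mu> n (k - 1))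
    + (real k - real n * \<mu>) * deg_Stirling2 \<mu> n k)"
  proof (rule deg_Stirling2_unique)
    fix x :: real
    show "deg_ffact \<mu> x (Suc n) = (\<Sum>k\<le>Suc n. ((if k = 0 then 0 else deg_Stirling2 \<mu> n (k - 1))
        + (real k - real n * \<mu>) * deg_Stirling2 \<mu> n k) * deg_ffact 1 x k)"
      using deg_ffact_Suc_expansion[of \<mu> x n "deg_Stirling2 \<mu> n"]
      by (simp add: deg_ffact_eq_sum_deg_Stirling2[of \<mu> x n] deg_Stirling2_eq_0
          del: sum.atMost_Suc)
  qed (auto simp: deg_Stirling2_eq_0)
  then show ?thesis by simp
qed

text \<open>\<open>deg_Stirling2\<close> is characterised by the real expansion only; its recurrence transfers
  the expansion to any real field.\<close>

lemma deg_ffact_eq_sum_of_real_deg_Stirling2: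
  fixes x :: "'a::real_field"
  shows "deg_ffact \<mu> x n = (\<Sum>k\<le>n. of_real (deg_Stirling2 \<mu> n k) * deg_ffact 1 x k)"
proof (induction n)
  case 0
  \<comment> \<open>At order 0 the real expansion reads
    \<open>deg_Stirling2 \<mu> 0 0 = 1\<close>.\<close>
  show ?case using deg_ffact_eq_sum_deg_Stirling2[of \<mu> 0 0] by simp
next
  case (Suc n)
  from deg_ffact_Suc_expansion[OF this deg_Stirling2_eq_0] show ?case
    by (simp add: deg_Stirling2_Suc del: sum.atMost_Suc)
qed

text \<open>Pascal's rule for \<open>Suc n choose j\<close> separates the sum; shifting the index in
  the part with \<open>n choose (j - 1)\<close> flips the sign and moves \<open>z\<close> to
  \<open>z - 1\<close>.\<close>

lemma backward_difference_Suc: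
  fixes f :: "'a::comm_ring_1 \<Rightarrow> 'a"
  shows "(\<Sum>j\<le>Suc n. (-1) ^ j * of_nat (Suc n choose j) * f (z - of_nat j))
    = (\<Sum>j\<le>n. (-1) ^ j * of_nat (n choose j) * f (z - of_nat j))
      - (\<Sum>j\<le>n. (-1) ^ j * of_nat (n choose j) * f (z - 1 - of_nat j))"
proof -
  have "(\<Sum>j\<le>Suc n. (-1) ^ j * of_nat (Suc n choose j) * f (z - of_nat j))
    = f z + (\<Sum>j\<le>n. (-1) ^ Suc j * of_nat (n choose Suc j) * f (z - of_nat (Suc j)))
      - (\<Sum>j\<le>n. (-1) ^ j * of_nat (n choose j) * f (z - 1 - of_nat j))"
    by (subst sum.atMost_Suc_shift)
      (simp add: sum_subtractf[symmetric] sum.distrib[symmetric] sum_negf[symmetric] algebra_simps)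
  \<comment> \<open>\<open>f z\<close> is the term \<open>j = 0\<close>; the surplus term
    \<open>j = Suc n\<close> vanishes later, as \<open>n choose Suc n = 0\<close>.\<close>
  also have "f z + (\<Sum>j\<le>n. (-1) ^ Suc j * of_nat (n choose Suc j) * f (z - of_nat (Suc j)))
    = (\<Sum>j\<le>Suc n. (-1) ^ j * of_nat (n choose j) * f (z - of_nat j))"
    by (subst sum.atMost_Suc_shift) simp
  finally show ?thesis by (simp add: binomial_eq_0)
qed

lemma backward_difference_gbinomial:
  fixes z :: "'a::field_char_0"
  shows "(\<Sum>j\<le>n. (-1) ^ j * of_nat (n choose j) * ((z - of_nat j) gchoose k))
    = (if n \<le> k then (z - of_nat n) gchoose (k - n) else 0)"
proof (induction n arbitrary: z)
  case 0
  show ?case by simp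
next
  case (Suc n)
  have pascal: "(w gchoose Suc m) - (w - 1 gchoose Suc m) = (w - 1 gchoose m)" for w :: 'a and m
    using gbinomial_Suc_Suc[of "w - 1" m] by simp
  note step = backward_difference_Suc[where f = "\<lambda>x. x gchoose k"]
  \<comment> \<open>The induction hypothesis is used at \<open>z\<close> and \<open>z - 1\<close>.
    For \<open>n = k\<close> both values are \<open>1\<close> and cancel; for \<open>k < n\<close>
    both are \<open>0\<close>; only the first case needs \<open>pascal\<close>.\<close>
  consider "Suc n \<le> k" | "n = k" | "k < n" by linarith
  then show ?case
  proof cases
    case 1
    then obtain m where "k = Suc n + m" using le_Suc_ex by blast
    then show ?thesis
      unfolding step Suc.IH using pascal[of "z - of_nat n" m]
      by (simp add: Suc_diff_le algebra_simps)
  qed (unfold step Suc.IH, simp_all)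
qed

theorem theorem2p7:
  fixes l :: real and n \<alpha> :: nat and z :: "'a::real_field"
  assumes "l \<noteq> 0" and "n > 0" and "\<alpha> > 0"
  shows "(\<Sum>j=0..n. (-1) ^ j * of_nat (n choose j) * deg_ffact l (z - of_nat j) (n + \<alpha>))
    = (\<Sum>r=0..\<alpha>. ((z - of_nat n) gchoose r) * fact (n + r)
         * of_real (deg_Stirling2 l (n + \<alpha>) (r + n)))"
proof -
  define a :: "nat \<Rightarrow> 'a" where "a k = of_real (deg_Stirling2 l (n + \<alpha>) k) * fact k" for k
  have "(\<Sum>j=0..n. (-1) ^ j * of_nat (n choose j) * deg_ffact l (z - of_nat j) (n + \<alpha>))
      = (\<Sum>j\<le>n. \<Sum>k\<le>n+\<alpha>. a k * ((-1) ^ j * of_nat (n choose j) * ((z - of_nat j) gchoose k)))"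
    unfolding deg_ffact_eq_sum_of_real_deg_Stirling2[of l _ "n + \<alpha>"] deg_ffact_1_eq_gbinomial a_def
    by (simp add: sum_distrib_left atLeast0AtMost mult_ac)
  also have "\<dots> = (\<Sum>k\<le>n+\<alpha>. a k
      * (\<Sum>j\<le>n. (-1) ^ j * of_nat (n choose j) * ((z - of_nat j) gchoose k)))"
    by (subst sum.swap) (simp add: sum_distrib_left)
  also have "\<dots> = (\<Sum>k\<le>n+\<alpha>. a k * (if n \<le> k then (z - of_nat n) gchoose (k - n) else 0))"
    by (simp only: backward_difference_gbinomial)
  also have "\<dots> = (\<Sum>k=n..n+\<alpha>. a k * ((z - of_nat n) gchoose (k - n)))"
    by (intro sum.mono_neutral_cong_right) auto
  also have "\<dots> = (\<Sum>r=0..\<alpha>. a (r + n) * ((z - of_nat n) gchoose r))"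
    using sum.shift_bounds_cl_nat_ivl[of "\<lambda>k. a k * ((z - of_nat n) gchoose (k - n))" 0 n \<alpha>]
    by (simp add: add.commute)
  finally show ?thesis by (simp add: a_def mult_ac add.commute)
qed

end
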